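(* Let $p$ be a prime and let $$I_{23,43} = \begin{pmatrix} 1 & 0 & 0 & 0 & 0\\ 0 & -1 & 1 & 0 & 0\\ 0 & 0 & 1 & 0 & 0\\ 0 & 0 & 1 & -1 & 0\\ 0 & 0 & 0 & 0 & 1\end{pmatrix},\quad F_L = \begin{pmatrix} 1 & 0 & 0 & 0 & 0\\ 0 & 0 & 0 & 0 & 1\\ 0 & 0 & 0 & 1 & 0\\ 0 & 0 & 1 & 0 & 0\\ 0 & 1 & 0 & 0 & 0\end{pmatrix},\quad D_0 = \begin{pmatrix} 0 & 0 & 0 & 0 & -1\\ 0 & 0 & 0 & -1 & 0\\ 0 & 0 & -1 & 0 & 0\\ 0 & -1 & 0 & 0 & 0\\ -1 & 0 & 0 & 0 & 0\end{pmatrix}$$ over $\mathbb{F}_p$. Then $\{I_{23,43}, F_L, D_0\}$ is a minimal involutive generating set of $ESL_5(\mathbb{F}_p)$; it is a Mazurov triple, and it satisfies the sggi property.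
   Context: $ESL_n(\mathbb{F}_p)$ denotes the group of all $n\times n$ matrices over $\mathbb{F}_p$ with determinant $1$ or $-1$. An involutive generating set of a group is a generating set all of whose elements are involutions (elements of order $2$); it is minimal if no involutive generating set of smaller cardinality exists. A Mazurov triple of a group is a generating set consisting of three involutions, two of which commute (also called type $(2\times 2,2)$). A generating set of involutions satisfies the sggi property (string group generated by involutions) if its elements can be ordered $\rho_0,\rho_1,\dots,\rho_{m-1}$ so that $\rho_i\rho_j=\rho_j\rho_i$ for all $i,j\in\{0,\dots,m-1\}$ with $|i-j|>1$.
   Formalization: The prime p = 2 is excluded: over F_2 all three matrices fix the all-ones row vector, so they generate only a proper subgroup of ESL_5(F_2) and the claim is false there; the formal theorem covers every odd prime p. *)

theory Defs
  imports
    "HOL-Library.Equipollence"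
    "HOL-Algebra.Generated_Groups"
    "HOL-Algebra.Multiplicative_Group"
    "Jordan_Normal_Form.Determinant"
    "Berlekamp_Zassenhaus.Finite_Field"
begin

definition ESL :: "nat \<Rightarrow> 'a :: comm_ring_1 mat monoid" where
  "ESL n = \<lparr>carrier = {A \<in> carrier_mat n n. det A = 1 \<or> det A = - 1},
            mult = (*), one = 1\<^sub>m n\<rparr>"

lemma group_ESL: "group (ESL n :: 'a :: field mat monoid)"
proof (rule groupI)
  fix A :: "'a mat"
  assume "A \<in> carrier (ESL n)"
  then have A: "A \<in> carrier_mat n n" and dA: "det A = 1 \<or> det A = - 1"
    by (auto simp: ESL_def)
  then have "A \<in> Units (ring_mat TYPE('a) n ())"
    by (auto intro!: det_non_zero_imp_unit)
  then obtain B where B: "B \<in> carrier_mat n n" and BA: "B * A = 1\<^sub>m n"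
    by (auto simp: Units_def ring_mat_def)
  have "det B * det A = 1"
    using det_mult[OF B A] BA by simp
  with dA have "det B = 1 \<or> det B = - 1"
    by (auto simp: minus_equation_iff)
  with B BA show "\<exists>B\<in>carrier (ESL n). B \<otimes>\<^bsub>ESL n\<^esub> A = \<one>\<^bsub>ESL n\<^esub>"
    by (auto simp: ESL_def)
qed (auto simp: ESL_def det_mult)

definition involution :: "('g, 'm) monoid_scheme \<Rightarrow> 'g \<Rightarrow> bool" where
  "involution G x \<longleftrightarrow> x \<in> carrier G \<and> group.ord G x = 2"

definition involutive_generating_set :: "('g, 'm) monoid_scheme \<Rightarrow> 'g set \<Rightarrow> bool" where
  "involutive_generating_set G S \<longleftrightarrow>
     (\<forall>x\<in>S. involution G x) \<and> generate G S = carrier G"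

definition minimal_involutive_generating_set ::
    "('g, 'm) monoid_scheme \<Rightarrow> 'g set \<Rightarrow> bool" where
  "minimal_involutive_generating_set G S \<longleftrightarrow>
     involutive_generating_set G S \<and> (\<nexists>T. involutive_generating_set G T \<and> T \<prec> S)"

definition mazurov_triple :: "('g, 'm) monoid_scheme \<Rightarrow> 'g set \<Rightarrow> bool" where
  "mazurov_triple G S \<longleftrightarrow>
     involutive_generating_set G S \<and> card S = 3 \<and>
     (\<exists>x\<in>S. \<exists>y\<in>S. x \<noteq> y \<and> x \<otimes>\<^bsub>G\<^esub> y = y \<otimes>\<^bsub>G\<^esub> x)"

definition sggi_property :: "('g, 'm) monoid_scheme \<Rightarrow> 'g set \<Rightarrow> bool" where
  "sggi_property G S \<longleftrightarrow>
     involutive_generating_set G S \<and>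
     (\<exists>\<rho>. distinct \<rho> \<and> set \<rho> = S \<and>
        (\<forall>i<length \<rho>. \<forall>j<length \<rho>. \<bar>int i - int j\<bar> > 1 \<longrightarrow>
           \<rho> ! i \<otimes>\<^bsub>G\<^esub> \<rho> ! j = \<rho> ! j \<otimes>\<^bsub>G\<^esub> \<rho> ! i))"

definition I_23_43 :: "'a :: comm_ring_1 mat" where
  "I_23_43 = mat_of_rows_list 5
    [[1,  0, 0,  0, 0],
     [0, -1, 1,  0, 0],
     [0,  0, 1,  0, 0],
     [0,  0, 1, -1, 0],
     [0,  0, 0,  0, 1]]"

definition F_L :: "'a :: comm_ring_1 mat" where
  "F_L = mat_of_rows_list 5
    [[1, 0, 0, 0, 0],
     [0, 0, 0, 0, 1],
     [0, 0, 0, 1, 0],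
     [0, 0, 1, 0, 0],
     [0, 1, 0, 0, 0]]"

definition D_0 :: "'a :: comm_ring_1 mat" where
  "D_0 = mat_of_rows_list 5
    [[ 0,  0,  0,  0, -1],
     [ 0,  0,  0, -1,  0],
     [ 0,  0, -1,  0,  0],
     [ 0, -1,  0,  0,  0],
     [-1,  0,  0,  0,  0]]"

text \<open>
  In characteristic 2 every column of the three matrices sums to 1, so they fix the
  all-ones row vector and generate a proper subgroup. Hence the prime 2 has to be excluded.
\<close>

lemma not_generating_char_2:
  assumes "CARD('p :: prime_card) = 2"
  shows "generate (ESL 5) {I_23_43, F_L, D_0} \<noteq> carrier (ESL 5 :: 'p mod_ring mat monoid)"
proof
  let ?G = "ESL 5 :: 'p mod_ring mat monoid"
  interpret group ?G by (rule group_ESL)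
  define J :: "'p mod_ring mat" where "J = mat 1 5 (\<lambda>_. 1)"
  have J: "J \<in> carrier_mat 1 5" by (simp add: J_def)
  have two: "(1 :: 'p mod_ring) + 1 = 0"
    using of_nat_card_eq_0[where 'a = 'p] assms by simp
  then have neg: "- 1 = (1 :: 'p mod_ring)" by (rule minus_unique)
  have "(3 :: 'p mod_ring) = (1 + 1) + 1" by simp
  then have three: "(3 :: 'p mod_ring) = 1" by (simp only: two add_0_left)
  have lt5: "j < 5 \<longleftrightarrow> j \<in> {0, 1, 2, 3, 4}" for j :: nat by auto
  have up5: "{0..<5} = {0, 1, 2, 3, 4 :: nat}" by auto
  have gens: "J * A = J" if "A \<in> {I_23_43, F_L, D_0}" for A
    using that
    by (auto intro!: eq_matI
        simp: J_def I_23_43_def F_L_def D_0_def mat_of_rows_list_def scalar_prod_def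
          lt5 up5 neg three)
  assume gen: "generate ?G {I_23_43, F_L, D_0} = carrier ?G"
  have carr: "{I_23_43, F_L, D_0} \<subseteq> carrier ?G"
    unfolding gen[symmetric] by (blast intro: generate.incl)
  have inv_fixes: "J * (inv\<^bsub>?G\<^esub> A) = J" if "A \<in> carrier ?G" "J * A = J" for A
  proof -
    have A: "A \<in> carrier_mat 5 5" "inv\<^bsub>?G\<^esub> A \<in> carrier_mat 5 5"
      using that(1) inv_closed[OF that(1)] by (auto simp: ESL_def)
    have "A * (inv\<^bsub>?G\<^esub> A) = 1\<^sub>m 5"
      using r_inv[OF that(1)] by (simp add: ESL_def)
    then show ?thesis
      using assoc_mult_mat[OF J A] that(2) J by simp
  qed
  have fixed: "A \<in> carrier ?G \<and> J * A = J" if "A \<in> generate ?G {I_23_43, F_L, D_0}" for A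
    using that
  proof (induction rule: generate.induct)
    case one
    then show ?case using J by (simp add: ESL_def)
  next
    case (incl h)
    then show ?case using carr gens by blast
  next
    case (inv h)
    then show ?case using carr gens inv_fixes inv_closed by blast
  next
    case (eng h1 h2)
    then have "h1 \<in> carrier_mat 5 5" "h2 \<in> carrier_mat 5 5" by (auto simp: ESL_def)
    with eng J have "J * (h1 * h2) = J"
      using assoc_mult_mat[OF J, of h1 5 h2 5] by simp
    with eng show ?case using m_closed[of h1 h2] by (simp add: ESL_def)
  qed
  define E :: "'p mod_ring mat" where "E = addrow_mat 5 1 0 1"
  have "E \<in> carrier ?G" by (simp add: E_def ESL_def det_addrow_mat)
  with gen fixed have "J * E = J" by blast
  then have "(J * E) $$ (0, 1) = J $$ (0, 1)" by simp
  then show False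
    by (simp add: J_def E_def addrow_mat_def scalar_prod_def up5 two
        flip: one_add_one)
qed

end

theory Submission
  imports Defs
begin

text \<open>
  Write \<open>I\<close>, \<open>F\<close>, \<open>D\<close> for the three matrices and \<open>e\<^sub>0, \<dots>, e\<^sub>4\<close> for the standard
  basis. Up to sign, \<open>F\<close> and \<open>D\<close> permute the basis as the reflections \<open>k \<mapsto> - k\<close> and
  \<open>k \<mapsto> - 1 - k\<close> of the pentagon \<open>\<int>/5\<close>. Their product \<open>F D\<close> is thus minus the 5-cycle
  \<open>e\<^sub>k \<mapsto> e\<^sub>k\<^sub>+\<^sub>1\<close>.

  Generation. The word \<open>(I F D F)\<^sup>4\<close> is a transvection. After a conjugation by \<open>D F D\<close> it differs
  from the identity only in row 0, where its off-diagonal entries are \<open>(2, 0, 0, -2)\<close>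
  (lemma \<open>transvection_word\<close>). The vectors that occur in this way as row 0 of an
  element of the generated group form an additive group, stable under conjugation by \<open>I\<close> and \<open>F\<close>,
  as both have \<open>e\<^sub>0\<close> as first row and as first column. It contains
  \<open>(-2, 0, 2, -2) + (2, 0, -2, -2) = (0, 0, 0, -4)\<close>. As 4 is invertible for odd \<open>p\<close> and every
  element of the prime field is a multiple of it, all vectors \<open>(0, 0, 0, a)\<close>
  occur, and \<open>I\<close> and \<open>F\<close> turn these into all others. Conjugation by the cycle \<open>F D\<close> moves
  row 0 to any other row, so every elementary matrix is generated. By Gaussian elimination
  (\<open>det_1_addrow_induct\<close>) these generate the matrices of determinant 1, and \<open>D\<close>, of
  determinant \<open>-1\<close>, supplies the other coset.

  Minimality. Two involutions generate a dihedral group, where any two squares commute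
  (\<open>squares_commute_if_two_involutions\<close>). The squares of an upper and a lower
  elementary matrix do not commute when \<open>p\<close> is odd.

  Finally \<open>I\<close> and \<open>D\<close> commute because \<open>I\<close> is invariant under reversing the basis; this is the commuting
  pair of the Mazurov triple, and \<open>I, F, D\<close> is the required string order.
\<close>

section \<open>Groups generated by two involutions\<close>

text \<open>
  Conjugation by \<open>a\<close> is an automorphism that sends the rotation \<open>a b\<close> to
  \<open>b a\<close>, its inverse.
\<close>

lemma (in group) involution_inverts_product:
  assumes a: "a \<in> carrier G" "a \<otimes> a = \<one>" and b: "b \<in> carrier G" "b \<otimes> b = \<one>"
  shows "a \<otimes> (a \<otimes> b) [^] (k :: int) = (a \<otimes> b) [^] (- k) \<otimes> a"
proof -
  define c where "c = a \<otimes> b"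
  have c: "c \<in> carrier G" using a b by (simp add: c_def)
  have inva: "inv a = a" and invb: "inv b = b"
    using a b by (auto intro: inv_equality)
  have "a \<otimes> (a \<otimes> z) = z" if "z \<in> carrier G" for z
    using a that by (simp add: m_assoc[symmetric])
  then have "(\<lambda>x. a \<otimes> x \<otimes> a) \<in> hom G G"
    using a by (intro homI) (simp_all add: m_assoc)
  then have "a \<otimes> c [^] k \<otimes> a = (a \<otimes> c \<otimes> a) [^] k"
    using hom_int_pow[of "\<lambda>x. a \<otimes> x \<otimes> a" G G c k] c is_group by simp
  moreover have "a \<otimes> c \<otimes> a = inv c"
    using a b by (simp add: c_def inv_mult_group inva invb m_assoc[symmetric])
  ultimately have "a \<otimes> c [^] k \<otimes> a = c [^] (- k)"
    using c by (simp add: inva int_pow_inv int_pow_neg)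
  then have "a \<otimes> c [^] k \<otimes> a \<otimes> a = c [^] (- k) \<otimes> a" by simp
  then show ?thesis
    using a c by (simp add: m_assoc c_def)
qed

text \<open>The normal form of a dihedral group: each element is a rotation or a reflection.\<close>

lemma (in group) generate_two_involutions:
  assumes a: "a \<in> carrier G" "a \<otimes> a = \<one>" and b: "b \<in> carrier G" "b \<otimes> b = \<one>"
    and x: "x \<in> generate G {a, b}"
  shows "\<exists>k::int. x = (a \<otimes> b) [^] k \<or> x = (a \<otimes> b) [^] k \<otimes> a"
  using x
proof (induction rule: generate.induct)
  let ?c = "a \<otimes> b"
  have c: "?c \<in> carrier G" using a b by simp
  have inva: "inv a = a" and invb: "inv b = b"
    using a b by (auto intro: inv_equality)
  have b_eq: "b = ?c [^] (- 1 :: int) \<otimes> a"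
    using a b by (simp add: int_pow_neg inv_mult_group inva invb m_assoc)
  {
    case one
    show ?case by (rule exI[of _ 0]) simp
  next
    case (incl h)
    then show ?case using a b_eq by (metis empty_iff insert_iff int_pow_0 l_one)
  next
    case (inv h)
    then show ?case using a b_eq inva invb by (metis empty_iff insert_iff int_pow_0 l_one)
  next
    case (eng g h)
    then obtain k l :: int where g: "g = ?c [^] k \<or> g = ?c [^] k \<otimes> a"
      and h: "h = ?c [^] l \<or> h = ?c [^] l \<otimes> a" by blast
    have flip: "?c [^] k \<otimes> a \<otimes> ?c [^] l = ?c [^] (k - l) \<otimes> a"
      using a c involution_inverts_product[OF a b, of l] int_pow_mult[OF c, of k "- l"]
      by (metis int_pow_closed m_assoc diff_conv_add_uminus)
    then have "?c [^] k \<otimes> a \<otimes> (?c [^] l \<otimes> a) = ?c [^] (k - l)"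
      using a c by (metis int_pow_closed m_assoc m_closed r_one)
    then show ?case
      using g h a c flip by (metis int_pow_mult int_pow_closed m_assoc)
  }
qed

text \<open>
  Reflections square to the identity and rotations square to rotations, which all lie in one
  cyclic group. This separates dihedral groups from larger linear groups without computing any order.
\<close>

lemma (in group) squares_commute_if_two_involutions:
  assumes a: "a \<in> carrier G" "a \<otimes> a = \<one>" and b: "b \<in> carrier G" "b \<otimes> b = \<one>"
    and x: "x \<in> generate G {a, b}" and y: "y \<in> generate G {a, b}"
  shows "(x \<otimes> x) \<otimes> (y \<otimes> y) = (y \<otimes> y) \<otimes> (x \<otimes> x)"
proof -
  let ?c = "a \<otimes> b"
  have c: "?c \<in> carrier G" using a b by simp
  have sq: "\<exists>k::int. z \<otimes> z = ?c [^] k" if z: "z \<in> generate G {a, b}" for z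
  proof -
    obtain k :: int where "z = ?c [^] k \<or> z = ?c [^] k \<otimes> a"
      using generate_two_involutions[OF a b z] by blast
    then show ?thesis
    proof
      assume "z = ?c [^] k"
      then show ?thesis using c by (metis int_pow_mult)
    next
      assume "z = ?c [^] k \<otimes> a"
      then have "z \<otimes> z = ?c [^] k \<otimes> (a \<otimes> ?c [^] k) \<otimes> a"
        using a c by (simp add: m_assoc)
      also have "\<dots> = ?c [^] k \<otimes> ?c [^] (- k) \<otimes> (a \<otimes> a)"
        unfolding involution_inverts_product[OF a b] using a c by (simp add: m_assoc)
      also have "\<dots> = ?c [^] (0 :: int)"
        using a c int_pow_mult[OF c, of k "- k"] by simp
      finally show ?thesis by blast
    qed
  qed
  obtain k l :: int where "x \<otimes> x = ?c [^] k" "y \<otimes> y = ?c [^] l"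
    using sq[OF x] sq[OF y] by blast
  then show ?thesis using int_pow_mult[OF c, of k l] int_pow_mult[OF c, of l k] by (simp add: add.commute)
qed

section \<open>Elementary matrices generate the special linear group\<close>

text \<open>
  Gaussian elimination, read as an induction principle. A row operation is undone by another
  one, so \<open>P\<close> may be proved for any matrix reached from \<open>A\<close> by row operations.
  The columns are turned into unit vectors from left to right. Since rows may be neither
  swapped nor scaled, a pivot 1 is created by adding a suitable multiple of a lower row; in the
  last column there is no lower row, but there the pivot equals the determinant.
\<close>

lemma det_1_addrow_induct:
  fixes A :: "'a :: field mat"
  assumes one: "P (1\<^sub>m n)"
    and addrow: "\<And>a i j B. i < n \<Longrightarrow> j < n \<Longrightarrow> i \<noteq> j \<Longrightarrow> B \<in> carrier_mat n n \<Longrightarrow> P B \<Longrightarrow> P (addrow a i j B)"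
    and A: "A \<in> carrier_mat n n" "det A = 1"
  shows "P A"
proof -
  define unit where "unit B j \<longleftrightarrow> (\<forall>i<n. B $$ (i, j) = (if i = j then 1 else 0))" for B :: "'a mat" and j
  have undo: "P B" if "P (addrow a i j B)" "i < n" "j < n" "i \<noteq> j" "B \<in> carrier_mat n n" for a i j B
  proof -
    have "addrow (- a) i j (addrow a i j B) = B"
      using that by (intro eq_matI) auto
    then show ?thesis using addrow[of i j "addrow a i j B" "- a"] that by simp
  qed
  have "P B" if "k \<le> n" "B \<in> carrier_mat n n" "det B = 1" "\<forall>j<k. unit B j" for k B
    using that
  proof (induction k arbitrary: B rule: inc_induct)
    case base
    then have "B = 1\<^sub>m n" by (intro eq_matI) (auto simp: unit_def)
    then show ?case using one by simp
  next
    case (step k)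
    note k = \<open>k < n\<close>
    have pivot1: "P B" if "B \<in> carrier_mat n n" "det B = 1" "\<forall>j<k. unit B j" "B $$ (k, k) = 1" for B
      using that
    proof (induction "card {i. i < n \<and> i \<noteq> k \<and> B $$ (i, k) \<noteq> 0}" arbitrary: B rule: less_induct)
      case less
      show ?case
      proof (cases "\<exists>i<n. i \<noteq> k \<and> B $$ (i, k) \<noteq> 0")
        case False
        then have "unit B k" using less.prems by (auto simp: unit_def)
        then show ?thesis using step.IH[of B] less.prems by (auto simp: less_Suc_eq)
      next
        case True
        then obtain i where i: "i < n" "i \<noteq> k" "B $$ (i, k) \<noteq> 0" by blast
        define C where "C = addrow (- B $$ (i, k)) i k B"
        have C: "C $$ (r, s) = (if r = i then B $$ (i, s) - B $$ (i, k) * B $$ (k, s) else B $$ (r, s))"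
          if "r < n" "s < n" for r s
          using that less.prems k by (auto simp: C_def)
        have "{r. r < n \<and> r \<noteq> k \<and> C $$ (r, k) \<noteq> 0} \<subset> {r. r < n \<and> r \<noteq> k \<and> B $$ (r, k) \<noteq> 0}"
        proof
          show "{r. r < n \<and> r \<noteq> k \<and> C $$ (r, k) \<noteq> 0} \<subseteq> {r. r < n \<and> r \<noteq> k \<and> B $$ (r, k) \<noteq> 0}"
            using k less.prems by (auto simp: C split: if_splits)
          have "C $$ (i, k) = 0" using i k less.prems by (simp add: C)
          then show "{r. r < n \<and> r \<noteq> k \<and> C $$ (r, k) \<noteq> 0} \<noteq> {r. r < n \<and> r \<noteq> k \<and> B $$ (r, k) \<noteq> 0}"
            using i by blast
        qed
        then have "card {r. r < n \<and> r \<noteq> k \<and> C $$ (r, k) \<noteq> 0} < card {r. r < n \<and> r \<noteq> k \<and> B $$ (r, k) \<noteq> 0}"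
          by (intro psubset_card_mono) auto
        moreover have "C \<in> carrier_mat n n" "C $$ (k, k) = 1" using less.prems i k
          by (auto simp: C_def)
        moreover have "det C = 1" using det_addrow[of k n i B] less.prems i k by (simp add: C_def)
        moreover have "\<forall>j<k. unit C j"
          using less.prems(3) k i by (auto simp: unit_def C)
        ultimately have "P C" using less.hyps by blast
        then show ?thesis using undo i k less.prems by (auto simp: C_def)
      qed
    qed
    \<comment> \<open>Any nonzero entry below the diagonal can be used to turn the diagonal entry into 1.\<close>
    have pivot_below: "P B" if B: "B \<in> carrier_mat n n" "det B = 1" "\<forall>j<k. unit B j"
        and i: "k < i" "i < n" "B $$ (i, k) \<noteq> 0" for B i
    proof (rule undo)
      let ?a = "(1 - B $$ (k, k)) / B $$ (i, k)"
      show "P (addrow ?a k i B)"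
      proof (rule pivot1)
        show "\<forall>j<k. unit (addrow ?a k i B) j"
          using B i k by (auto simp: unit_def)
      qed (use B i k in \<open>auto simp: det_addrow\<close>)
    qed (use B i k in auto)
    show ?case
    proof (cases "\<exists>i. k < i \<and> i < n \<and> B $$ (i, k) \<noteq> 0")
      case True
      then show ?thesis using pivot_below step.prems by blast
    next
      case False
      \<comment> \<open>Otherwise column \<open>k\<close> would be a combination of the unit columns before it; \<open>v\<close> is this
        linear dependence.\<close>
      have nz: "B $$ (k, k) \<noteq> 0"
      proof
        assume kk: "B $$ (k, k) = 0"
        define v where "v = vec n (\<lambda>j. if j < k then - B $$ (j, k) else if j = k then 1 else 0)"
        have "B *\<^sub>v v = 0\<^sub>v n"
        proof (rule eq_vecI)
          fix i assume "i < dim_vec (0\<^sub>v n :: 'a vec)"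
          then have i: "i < n" by simp
          have "(B *\<^sub>v v) $ i = (\<Sum>j<n. B $$ (i, j) * v $ j)"
            using i step.prems(1) by (simp add: v_def scalar_prod_def lessThan_atLeast0)
          also have "\<dots> = (\<Sum>j<n. (if j = i \<and> j < k then - B $$ (i, k) else 0) + (if j = k then B $$ (i, k) else 0))"
            using step.prems(3) i k by (intro sum.cong) (auto simp: v_def unit_def)
          also have "\<dots> = (if i < k then - B $$ (i, k) else 0) + B $$ (i, k)"
            using i k by (simp add: sum.distrib) (auto simp: sum.delta' cong: conj_cong)
          also have "\<dots> = 0" using False kk i by (cases i k rule: linorder_cases) auto
          finally show "(B *\<^sub>v v) $ i = 0\<^sub>v n $ i" using i by simp
        qed (use step.prems in simp)
        moreover have "v \<noteq> 0\<^sub>v n"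
        proof
          assume "v = 0\<^sub>v n"
          then have "v $ k = 0" using k by simp
          then show False using k by (simp add: v_def)
        qed
        moreover have "v \<in> carrier_vec n" by (simp add: v_def)
        ultimately have "det B = 0" using det_0_iff_vec_prod_zero_field[OF step.prems(1)] by blast
        then show False using step.prems by simp
      qed
      show ?thesis
      proof (cases "Suc k < n")
        case True
        \<comment> \<open>Copying the nonzero pivot into the next row provides the entry below the diagonal.\<close>
        show ?thesis
        proof (rule undo)
          show "P (addrow 1 (Suc k) k B)"
          proof (rule pivot_below)
            show "\<forall>j<k. unit (addrow 1 (Suc k) k B) j"
              using step.prems True by (auto simp: unit_def)
            show "addrow 1 (Suc k) k B $$ (Suc k, k) \<noteq> 0"
              using False nz True step.prems by auto
            show "det (addrow 1 (Suc k) k B) = 1"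
              using det_addrow[of k n "Suc k" B 1] step.prems True by simp
          qed (use step.prems True in auto)
        qed (use step.prems True in auto)
      next
        case last: False
        have "upper_triangular B"
          using step.prems last by (auto simp: unit_def upper_triangular_def)
        then have "det B = prod_list (diag_mat B)"
          using det_upper_triangular step.prems by blast
        also have "\<dots> = (\<Prod>i<n. B $$ (i, i))"
          using step.prems by (simp add: prod_list_diag_prod lessThan_atLeast0)
        also have "\<dots> = (\<Prod>i<n. if i = k then B $$ (k, k) else 1)"
          using last step.prems(3) by (intro prod.cong) (auto simp: unit_def)
        also have "\<dots> = B $$ (k, k)" using k by simp
        finally show ?thesis using pivot1 step.prems by simp
      qed
    qed
  qed
  from this[of 0 A] A show ?thesis by simp
qed

section \<open>Identities between the three generators\<close>

text \<open>
  Identities between concrete matrices are checked entry by entry, for which indices and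
  sums below 5 have to be enumerated. The bound occurs both as a numeral and as a successor term,
  the normal form of the length of an explicit list of rows.
\<close>

lemma less_5_iff: "i < 5 \<longleftrightarrow> i \<in> {0, 1, 2, 3, 4}" for i :: nat
  by auto
lemma less_Suc5_iff: "i < Suc (Suc (Suc (Suc (Suc 0)))) \<longleftrightarrow> i \<in> {0, 1, 2, 3, 4}"
  by auto
lemma atLeastLessThan_0_5: "{0..<5} = {0, 1, 2, 3, 4 :: nat}"
  by auto

lemma I_23_43_carrier: "I_23_43 \<in> carrier_mat 5 5"
  and F_L_carrier: "F_L \<in> carrier_mat 5 5"
  and D_0_carrier: "D_0 \<in> carrier_mat 5 5"
  by (auto simp: I_23_43_def F_L_def D_0_def mat_of_rows_list_def)

lemmas generator_carriers = I_23_43_carrier F_L_carrier D_0_carrier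

lemmas entrywise = mat_of_rows_list_def scalar_prod_def less_5_iff less_Suc5_iff atLeastLessThan_0_5

text \<open>
  These matrices form a group isomorphic to the additive group of row
  vectors of length 4. It is normalised by \<open>I\<close> and \<open>F\<close>.
\<close>

definition top_row :: "'a :: comm_ring_1 \<Rightarrow> 'a \<Rightarrow> 'a \<Rightarrow> 'a \<Rightarrow> 'a mat" where
  "top_row a b c d = mat_of_rows_list 5
    [[1, a, b, c, d],
     [0, 1, 0, 0, 0],
     [0, 0, 1, 0, 0],
     [0, 0, 0, 1, 0],
     [0, 0, 0, 0, 1]]"

lemma generators_square:
  "I_23_43 * I_23_43 = (1\<^sub>m 5 :: 'a :: comm_ring_1 mat)"
  "F_L * F_L = (1\<^sub>m 5 :: 'a :: comm_ring_1 mat)"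
  "D_0 * D_0 = (1\<^sub>m 5 :: 'a :: comm_ring_1 mat)"
  by (rule eq_matI; auto simp: I_23_43_def F_L_def D_0_def entrywise)+

lemma I_23_43_D_0_commute: "I_23_43 * D_0 = (D_0 * I_23_43 :: 'a :: comm_ring_1 mat)"
  by (rule eq_matI; auto simp: I_23_43_def F_L_def D_0_def entrywise)+

lemma det_D_0: "det (D_0 :: 'a :: comm_ring_1 mat) = -1"
proof -
  have "D_0 = (- 1) \<cdot>\<^sub>m swaprows 0 4 (swaprows_mat 5 1 3 :: 'a mat)"
    by (rule eq_matI; auto simp: D_0_def entrywise)
  also have "det \<dots> = (- 1) ^ 5 * - det (swaprows_mat 5 1 3)"
    by (subst det_smult, subst det_swaprows[of _ 5]) simp_all
  also have "\<dots> = - 1"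
    by (subst det_swaprows_mat) simp_all
  finally show ?thesis .
qed

text \<open>
  The square of \<open>I F D F\<close> is \<open>-1\<close> on the plane of \<open>e\<^sub>0, e\<^sub>1\<close> and induces a transvection on
  the quotient by that plane. Squaring once more removes the sign and doubles the transvection. The
  entries of rows 0 and 1 outside of the plane cancel, as the eigenvalues \<open>-1\<close> and \<open>1\<close> add up to 0.
\<close>

lemma word_square: "(I_23_43 * F_L * D_0 * F_L) * (I_23_43 * F_L * D_0 * F_L) = (mat_of_rows_list 5
    [[-1,  0, 0, 0,  1],
     [ 0, -1, 1, 0,  0],
     [ 0,  0, 1, 0,  0],
     [ 0,  0, 1, 1, -1],
     [ 0,  0, 0, 0,  1]] :: 'a :: comm_ring_1 mat)" (is "?M * ?M = ?M2")
proof -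
  have "?M = mat_of_rows_list 5
    [[0, -1,  0, 0,  0],
     [1,  0,  0, 0, -1],
     [0,  0,  0, 0, -1],
     [0,  0,  0, 1, -1],
     [0,  0, -1, 0,  0]]"
    by (rule eq_matI; auto simp: I_23_43_def F_L_def D_0_def entrywise)
  then show ?thesis by (simp only:) (rule eq_matI; auto simp: entrywise)
qed

text \<open>
  The transvection \<open>(I F D F)\<^sup>4\<close> sits in row 3; the reflection \<open>D F D\<close> exchanges the
  indices 0 and 3.
\<close>

lemma transvection_word:
  fixes M :: "'a :: comm_ring_1 mat"
  defines "M \<equiv> (I_23_43 * F_L * D_0 * F_L) * (I_23_43 * F_L * D_0 * F_L)"
  shows "D_0 * F_L * D_0 * (M * M) * (D_0 * F_L * D_0) = top_row 2 0 0 (- 2)"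
proof -
  have "M * M = mat_of_rows_list 5
    [[1, 0, 0, 0, 0],
     [0, 1, 0, 0, 0],
     [0, 0, 1, 0, 0],
     [0, 0, 2, 1, -2],
     [0, 0, 0, 0, 1]]"
    unfolding M_def word_square
    by (rule eq_matI; auto simp: entrywise)
  then show ?thesis
    by (simp only:) (rule eq_matI; auto simp: top_row_def F_L_def D_0_def entrywise)
qed

lemma top_row_mult: "top_row a b c d * top_row a' b' c' d' = top_row (a + a') (b + b') (c + c') (d + d')"
  by (rule eq_matI; auto simp: top_row_def entrywise)

lemma top_row_conj_I: "I_23_43 * top_row a b c d * I_23_43 = top_row (- a) (a + b + c) (- c) d"
  by (rule eq_matI; auto simp: top_row_def I_23_43_def entrywise)

lemma top_row_conj_F: "F_L * top_row a b c d * F_L = top_row d c b a"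
  by (rule eq_matI; auto simp: top_row_def F_L_def entrywise)

text \<open>
  \<open>F D\<close> sends \<open>e\<^sub>k\<close> to \<open>- e\<^sub>k\<^sub>+\<^sub>1\<close>. The signs cancel under conjugation, which therefore
  shifts all entries cyclically along the diagonal. The predecessor modulo 5 is written as
  \<open>r + 4\<close>, subtraction being truncated at 0.
\<close>

lemma conj_cycle:
  fixes M :: "'a :: comm_ring_1 mat"
  assumes "M \<in> carrier_mat 5 5"
  shows "F_L * D_0 * M * (D_0 * F_L) = mat 5 5 (\<lambda>(r, s). M $$ ((r + 4) mod 5, (s + 4) mod 5))"
proof -
  define C :: "'a mat" where "C = mat 5 5 (\<lambda>(r, s). if s = (r + 4) mod 5 then - 1 else 0)"
  have C: "F_L * D_0 = C" "D_0 * F_L = transpose_mat C"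
    by (rule eq_matI; auto simp: C_def F_L_def D_0_def entrywise)+
  have delta: "(if P then - 1 else 0) * x = (if P then - x else 0)"
    "x * (if P then - 1 else 0) = (if P then - x else 0)" for P and x :: 'a
    by simp_all
  have "C * M = mat 5 5 (\<lambda>(r, s). - M $$ ((r + 4) mod 5, s))"
    using assms by (intro eq_matI) (simp_all add: C_def scalar_prod_def delta)
  then show ?thesis
    unfolding C by (intro eq_matI) (simp_all add: C_def scalar_prod_def delta)
qed

lemma conj_cycle_addrow_mat:
  fixes a :: "'a :: comm_ring_1"
  assumes "i < 5" "j < 5"
  shows "F_L * D_0 * addrow_mat 5 a i j * (D_0 * F_L) = addrow_mat 5 a (Suc i mod 5) (Suc j mod 5)"
proof -
  have "(r + 4) mod 5 = (s + 4) mod 5 \<longleftrightarrow> r = s" "k = (r + 4) mod 5 \<longleftrightarrow> Suc k mod 5 = r"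
    if "k < 5" "r < 5" "s < 5" for k r s :: nat
  proof -
    have pred: "(k + 4) mod 5 = (if k = 0 then 4 else k - 1)" if "k < 5" for k :: nat
      using that by (cases k) auto
    have succ: "Suc k mod 5 = (if k = 4 then 0 else Suc k)"
      using \<open>k < 5\<close> by (simp add: mod_Suc)
    show "(r + 4) mod 5 = (s + 4) mod 5 \<longleftrightarrow> r = s" "k = (r + 4) mod 5 \<longleftrightarrow> Suc k mod 5 = r"
      unfolding pred[OF \<open>r < 5\<close>] pred[OF \<open>s < 5\<close>] succ using that by (simp_all split: if_splits) linarith+
  qed
  then show ?thesis using assms by (subst conj_cycle) (auto intro!: eq_matI)
qed

lemma top_row_eq_addrow_mat:
  "top_row a 0 0 0 = addrow_mat 5 a 0 1" "top_row 0 a 0 0 = addrow_mat 5 a 0 2"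
  "top_row 0 0 a 0 = addrow_mat 5 a 0 3" "top_row 0 0 0 a = addrow_mat 5 a 0 4"
  "top_row 0 0 0 0 = 1\<^sub>m 5"
  by (rule eq_matI; auto simp: top_row_def entrywise)+

section \<open>The generated group\<close>

text \<open>An involution has determinant \<open>\<plusminus>1\<close>, its determinant being a square root of 1.\<close>

lemma generators_in_carrier:
  "{I_23_43, F_L, D_0} \<subseteq> carrier (ESL 5 :: 'a :: idom mat monoid)"
proof -
  have "det A * det A = 1" if "A * A = 1\<^sub>m 5" "A \<in> carrier_mat 5 5" for A :: "'a mat"
    using det_mult[OF that(2,2)] that(1) by simp
  then have "A \<in> carrier (ESL 5)" if "A * A = 1\<^sub>m 5" "A \<in> carrier_mat 5 5" for A :: "'a mat"
    using that by (auto simp: ESL_def square_eq_1_iff)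
  then show ?thesis
    by (simp add: generators_square generator_carriers)
qed

lemma four_neq_0_mod_ring:
  assumes "CARD('p :: prime_card) \<noteq> 2"
  shows "(4 :: 'p mod_ring) \<noteq> 0"
proof
  assume "(4 :: 'p mod_ring) = 0"
  then have "of_nat (2 * 2) = (0 :: 'p mod_ring)" by simp
  then have "CARD('p) dvd 2 * 2" by (rule of_nat_0_mod_ring_dvd)
  then have "CARD('p) dvd 2"
    using prime_card[where 'a = 'p] by (simp only: prime_dvd_mult_iff disj_absorb)
  then show False
    using assms prime_card[where 'a = 'p] by (simp add: primes_dvd_imp_eq)
qed

text \<open>
  The proof works with products alone: the generators are their own inverses, and the inverse
  of an elementary matrix is one of its powers, as the field is a prime field.
\<close>

lemma generators_generate_ESL_5:
  assumes "CARD('p :: prime_card) \<noteq> 2"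
  shows "generate (ESL 5) {I_23_43, F_L, D_0} = carrier (ESL 5 :: 'p mod_ring mat monoid)"
proof -
  let ?G = "ESL 5 :: 'p mod_ring mat monoid"
  define K where "K = generate ?G {I_23_43, F_L, D_0}"
  interpret group ?G by (rule group_ESL)
  have I: "I_23_43 \<in> K" and F: "F_L \<in> K" and D: "D_0 \<in> K"
    unfolding K_def by (rule generate.incl, simp)+
  have mult: "A * B \<in> K" if "A \<in> K" "B \<in> K" for A B
    using generate.eng[of A ?G _ B] that by (simp add: K_def ESL_def)
  have one: "1\<^sub>m 5 \<in> K"
    using generate.one[of ?G] by (simp add: K_def ESL_def)
  have conj_I: "top_row (- a) (a + b + c) (- c) d \<in> K" if "top_row a b c d \<in> K" for a b c d
    using mult[OF mult[OF I that] I] by (simp only: top_row_conj_I)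
  have conj_F: "top_row d c b a \<in> K" if "top_row a b c d \<in> K" for a b c d
    using mult[OF mult[OF F that] F] by (simp only: top_row_conj_F)

  \<comment> \<open>Conjugation by \<open>I\<close> and then \<open>F\<close> turns \<open>(2, 0, 0, -2)\<close> into \<open>(-2, 0, 2, -2)\<close>. A further
    conjugation by \<open>I\<close> negates all of its entries except the last one, so that the sum of the
    last two vectors has a single nonzero entry.\<close>
  have t0: "top_row 2 0 0 (- 2) \<in> K"
    unfolding transvection_word[symmetric] by (intro mult I F D)
  have t1: "top_row (- 2) 0 2 (- 2) \<in> K"
    using conj_F[OF conj_I[OF t0]] by simp
  have "top_row 0 0 0 (- 4) \<in> K"
    using mult[OF t1 conj_I[OF t1]] by (simp add: top_row_mult)
  then have multiples: "top_row 0 0 0 (of_nat m * - 4) \<in> K" for m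
  proof (induction m)
    case 0
    show ?case using one by (simp add: top_row_eq_addrow_mat(5))
  next
    case (Suc m)
    then show ?case
      using mult[of "top_row 0 0 0 (- 4)" "top_row 0 0 0 (of_nat m * - 4)"]
      by (simp add: top_row_mult algebra_simps)
  qed
  have top4: "top_row 0 0 0 a \<in> K" for a
  proof -
    obtain m where "a / - 4 = of_nat m"
      using surj_of_nat_mod_ring by blast
    then have "of_nat m * - 4 = a"
      using four_neq_0_mod_ring[OF assms] by (metis neg_equal_0_iff_equal nonzero_divide_eq_eq)
    then show ?thesis using multiples[of m] by simp
  qed
  \<comment> \<open>\<open>I\<close> maps \<open>(a, 0, 0, 0)\<close> to \<open>(-a, a, 0, 0)\<close>, and \<open>F\<close> reverses the four entries.\<close>
  have top1: "top_row a 0 0 0 \<in> K" for a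
    using conj_F[OF top4] .
  have top2: "top_row 0 a 0 0 \<in> K" for a
    using mult[OF top1[of a] conj_I[OF top1[of a]]] by (simp add: top_row_mult)
  have top3: "top_row 0 0 a 0 \<in> K" for a
    using conj_F[OF top2] .

  have addrow_mat_K: "addrow_mat 5 a i j \<in> K" if "i < 5" "j < 5" "i \<noteq> j" for a i j
    using that
  proof (induction i arbitrary: j)
    case 0
    then have "j \<in> {1, 2, 3, 4}" by auto
    then show ?case
      using top1 top2 top3 top4 by (auto simp: top_row_eq_addrow_mat)
  next
    case (Suc i)
    \<comment> \<open>\<open>k\<close> is the cyclic predecessor of \<open>j\<close>.\<close>
    define k where "k = (j + 4) mod 5"
    have k: "k < 5" "Suc k mod 5 = j" "i \<noteq> k"
      using Suc.prems by (cases j; simp add: k_def mod_Suc)+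
    have "F_L * D_0 * addrow_mat 5 a i k * (D_0 * F_L) \<in> K"
      using Suc k by (intro mult F D) simp
    then show ?case
      using conj_cycle_addrow_mat[of i k a] Suc.prems k by simp
  qed
  have det_1: "A \<in> K" if "A \<in> carrier_mat 5 5" "det A = 1" for A
  proof (rule det_1_addrow_induct[of "\<lambda>B. B \<in> K" 5 A])
    show "addrow a i j B \<in> K"
      if "i < 5" "j < 5" "i \<noteq> j" "B \<in> carrier_mat 5 5" "B \<in> K" for a i j B
      using addrow_mat[of B 5 5 j a i] addrow_mat_K that mult by simp
  qed (use one that in auto)
  have "A \<in> K" if "A \<in> carrier ?G" for A
  proof (cases "det A = 1")
    case True
    then show ?thesis using that det_1 by (simp add: ESL_def)
  next
    case False
    then have A: "A \<in> carrier_mat 5 5" "det A = - 1" using that by (auto simp: ESL_def)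
    then have "D_0 * A \<in> K"
      using det_mult[OF D_0_carrier A(1)] by (intro det_1 mult_carrier_mat[OF D_0_carrier]) (simp_all add: det_D_0)
    then have "D_0 * (D_0 * A) \<in> K" using D mult by blast
    moreover have "D_0 * (D_0 * A) = A"
      using assoc_mult_mat[OF D_0_carrier D_0_carrier A(1)] A(1) by (simp add: generators_square)
    ultimately show ?thesis by simp
  qed
  moreover have "K \<subseteq> carrier ?G"
    using generate_in_carrier[OF generators_in_carrier] by (auto simp: K_def)
  ultimately show ?thesis by (auto simp: K_def)
qed

section \<open>Two involutions do not suffice\<close>

lemma (in group) involution_iff: "involution G x \<longleftrightarrow> x \<in> carrier G \<and> x \<noteq> \<one> \<and> x \<otimes> x = \<one>"
proof (cases "x \<in> carrier G")
  case True
  have "ord x = 2 \<longleftrightarrow> ord x dvd 2 \<and> ord x \<noteq> 1"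
    using prime_nat_iff two_is_prime_nat by auto
  then show ?thesis
    using True by (simp add: involution_def pow_eq_id[symmetric] ord_eq_1 power2_eq_square numeral_2_eq_2 del: One_nat_def) auto
qed (simp add: involution_def)

text \<open>
  With \<open>U\<close> and \<open>L\<close> the elementary matrices at positions \<open>(0, 1)\<close> and \<open>(1, 0)\<close>, the corner entry
  of \<open>U\<^sup>2 L\<^sup>2\<close> is \<open>1 + 2 \<cdot> 2 = 5\<close> and that of \<open>L\<^sup>2 U\<^sup>2\<close> is \<open>1\<close>, so the squares
  commute only in characteristic 2.
\<close>

lemma involutive_generating_set_ESL_card_ge_3:
  fixes T :: "'p :: prime_card mod_ring mat set"
  assumes "CARD('p) \<noteq> 2" "2 \<le> n"
    and T: "involutive_generating_set (ESL n) T" "finite T"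
  shows "3 \<le> card T"
proof (rule ccontr)
  let ?G = "ESL n :: 'p mod_ring mat monoid"
  interpret group ?G by (rule group_ESL)
  assume "\<not> 3 \<le> card T"
  then have "card T = 0 \<or> card T = 1 \<or> card T = 2" by linarith
  then obtain a b where "T = {} \<or> T = {a, b}"
    using T(2) by (metis card_0_eq card_1_singletonE card_2_iff insert_absorb2)
  \<comment> \<open>For fewer than two elements the identity fills the gap: it also squares to the identity.\<close>
  then obtain a b where T_sub: "T \<subseteq> {a, b}" and ab: "{a, b} \<subseteq> insert (1\<^sub>m n) T"
    by blast
  have inv: "x \<in> carrier ?G" "x \<otimes>\<^bsub>?G\<^esub> x = \<one>\<^bsub>?G\<^esub>" if "x \<in> {a, b}" for x
  proof -
    have "x = \<one>\<^bsub>?G\<^esub> \<or> involution ?G x"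
      using that ab T(1) by (auto simp: involutive_generating_set_def ESL_def)
    then show "x \<in> carrier ?G" "x \<otimes>\<^bsub>?G\<^esub> x = \<one>\<^bsub>?G\<^esub>"
      by (auto simp only: involution_iff one_closed l_one)
  qed
  have gen: "carrier ?G \<subseteq> generate ?G {a, b}"
    using mono_generate[OF T_sub] T(1) by (simp add: involutive_generating_set_def)
  let ?U = "addrow_mat n 1 0 1 :: 'p mod_ring mat" and ?L = "addrow_mat n 1 1 0 :: 'p mod_ring mat"
  have "?U \<in> carrier ?G" "?L \<in> carrier ?G"
    using assms(2) by (auto simp: ESL_def det_addrow_mat)
  then have "?U \<otimes>\<^bsub>?G\<^esub> ?U \<otimes>\<^bsub>?G\<^esub> (?L \<otimes>\<^bsub>?G\<^esub> ?L) = ?L \<otimes>\<^bsub>?G\<^esub> ?L \<otimes>\<^bsub>?G\<^esub> (?U \<otimes>\<^bsub>?G\<^esub> ?U)"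
    using squares_commute_if_two_involutions[of a b ?U ?L] inv gen by blast
  then have "?U * (?U * (?L * ?L)) = ?L * (?L * (?U * ?U))"
    by (simp add: ESL_def assoc_mult_mat[of _ n n _ n _ n] mult_carrier_mat[of _ n n])
  then have "addrow 1 0 1 (addrow 1 0 1 (addrow 1 1 0 ?L)) = addrow 1 1 0 (addrow 1 1 0 (addrow 1 0 1 ?U))"
    using assms(2) by (simp add: addrow_mat[of _ n n] mult_carrier_mat[of _ n n])
  then have "addrow 1 0 1 (addrow 1 0 1 (addrow 1 1 0 ?L)) $$ (0, 0)
      = addrow 1 1 0 (addrow 1 1 0 (addrow 1 0 1 ?U)) $$ (0, 0)" by simp
  then have "(5 :: 'p mod_ring) = 1"
    using assms(2) by simp
  moreover have "(5 :: 'p mod_ring) = 1 + 4" by simp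
  ultimately show False
    using four_neq_0_mod_ring[OF assms(1)] by (metis add_cancel_right_right)
qed

section \<open>The three involutions in the extended special linear group\<close>

theorem corollary3p3:
  assumes "CARD('p :: prime_card) \<noteq> 2"
  shows "minimal_involutive_generating_set (ESL 5 :: 'p mod_ring mat monoid) {I_23_43, F_L, D_0} \<and>
         mazurov_triple (ESL 5 :: 'p mod_ring mat monoid) {I_23_43, F_L, D_0} \<and>
         sggi_property (ESL 5 :: 'p mod_ring mat monoid) {I_23_43, F_L, D_0}"
proof -
  let ?G = "ESL 5 :: 'p mod_ring mat monoid"
  let ?S = "{I_23_43, F_L, D_0} :: 'p mod_ring mat set"
  interpret group ?G by (rule group_ESL)
  have entries:
    "I_23_43 $$ (0, 0) = (1 :: 'p mod_ring)" "F_L $$ (0, 0) = (1 :: 'p mod_ring)"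
    "D_0 $$ (0, 0) = (0 :: 'p mod_ring)"
    "I_23_43 $$ (1, 2) = (1 :: 'p mod_ring)" "F_L $$ (1, 2) = (0 :: 'p mod_ring)"
    "F_L $$ (1, 1) = (0 :: 'p mod_ring)"
    by (simp_all add: I_23_43_def F_L_def D_0_def mat_of_rows_list_def)
  have distinct: "distinct [I_23_43, F_L, D_0 :: 'p mod_ring mat]"
    using entries by auto
  have "A \<noteq> 1\<^sub>m 5" if "A \<in> ?S" for A
  proof
    assume "A = 1\<^sub>m 5"
    then have "A $$ (0, 0) = 1" "A $$ (1, 2) = 0" "A $$ (1, 1) = 1" by simp_all
    then show False using that entries by auto
  qed
  then have gen: "involutive_generating_set ?G ?S"
    using generators_in_carrier generators_generate_ESL_5[OF assms] generators_square
    by (auto simp: involutive_generating_set_def involution_iff) (auto simp: ESL_def)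
  have card: "card ?S = 3" using distinct by simp
  have "\<not> T \<prec> ?S" if "involutive_generating_set ?G T" for T
  proof
    assume "T \<prec> ?S"
    then have "finite T" "card T < card ?S"
      using card lesspoll_iff_finite_card eqpoll_iff_finite_card lesspoll_trans1
      by (metis card.infinite eqpoll_sym lesspoll_eq_trans zero_neq_numeral)+
    then show False using involutive_generating_set_ESL_card_ge_3[OF assms _ that] card by simp
  qed
  then have "minimal_involutive_generating_set ?G ?S"
    using gen by (auto simp: minimal_involutive_generating_set_def)
  moreover have "mazurov_triple ?G ?S"
    using gen card distinct I_23_43_D_0_commute
    by (auto simp: mazurov_triple_def ESL_def)
  moreover have "sggi_property ?G ?S"
    unfolding sggi_property_def
  proof (intro conjI exI)
    let ?\<rho> = "[I_23_43, F_L, D_0 :: 'p mod_ring mat]"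
    show "distinct ?\<rho>" by (rule distinct)
    show "\<forall>i<length ?\<rho>. \<forall>j<length ?\<rho>. \<bar>int i - int j\<bar> > 1 \<longrightarrow>
        ?\<rho> ! i \<otimes>\<^bsub>?G\<^esub> ?\<rho> ! j = ?\<rho> ! j \<otimes>\<^bsub>?G\<^esub> ?\<rho> ! i"
      using I_23_43_D_0_commute by (auto simp: ESL_def less_Suc_eq)
  qed (use gen in auto)
  ultimately show ?thesis by blast
qed

end
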